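(* Let $\mathcal{A}$ be a unital C*-algebra, let $\mathcal{E}$ be a finite rank (left) Hilbert C*-module over $\mathcal{A}$, and let $\{\tau_j\}_{j=1}^n$ be a unit inner product frame for $\mathcal{E}$. If $x\in\mathcal{E}$ can be written as $x=\theta_\tau^* c$ for some $c\in\mathcal{A}^n$ satisfying $$\|c\|_0<\frac{1}{2}\left(1+\frac{1}{\displaystyle\max_{1\leq j,k\leq n,\ j\neq k}\|\langle \tau_j,\tau_k\rangle\|}\right),$$ then $c$ is the unique solution to the problem $$\text{minimize }\{\|d\|_1: d\in\mathcal{A}^n\}\quad\text{subject to}\quad \theta_\tau^* d=x;$$ that is, $\theta_\tau^*c=x$ and every $d\in\mathcal{A}^n$ with $\theta_\tau^*d=x$ and $d\neq c$ satisfies $\|d\|_1>\|c\|_1$.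
   Context: A (left) Hilbert C*-module over a unital C*-algebra $\mathcal{A}$ is a left $\mathcal{A}$-module $\mathcal{E}$ with a map $\langle\cdot,\cdot\rangle:\mathcal{E}\times\mathcal{E}\to\mathcal{A}$ such that for all $x,y,z\in\mathcal{E}$, $a\in\mathcal{A}$: (i) $\langle x,x\rangle\geq 0$, and $\langle x,x\rangle=0$ implies $x=0$; (ii) $\langle x+y,z\rangle=\langle x,z\rangle+\langle y,z\rangle$; (iii) $\langle ax,y\rangle=a\langle x,y\rangle$; (iv) $\langle x,y\rangle=\langle y,x\rangle^*$; (v) $\mathcal{E}$ is complete for the norm $\|x\|=\sqrt{\|\langle x,x\rangle\|}$. Finite rank is understood as finitely generated (this holds automatically when a finite frame exists). A finite collection $\{\tau_j\}_{j=1}^n$ in $\mathcal{E}$ is a (modular) frame for $\mathcal{E}$ if there are real $a,b>0$ with $a\langle x,x\rangle\leq\sum_{j=1}^n\langle x,\tau_j\rangle\langle\tau_j,x\rangle\leq b\langle x,x\rangle$ for all $x\in\mathcal{E}$ (order in $\mathcal{A}$). It is a unit inner product frame if moreover $\langle\tau_j,\tau_j\rangle=1$ (the identity of $\mathcal{A}$) for all $1\leq j\leq n$. The modular synthesis morphism is $\theta_\tau^*:\mathcal{A}^n\to\mathcal{E}$, $\theta_\tau^*(a_j)_{j=1}^n=\sum_{j=1}^n a_j\tau_j$. For $d=(d_j)_{j=1}^n\in\mathcal{A}^n$, $\|d\|_0$ is the number of nonzero entries of $d$, and $\|d\|_1=\sum_{j=1}^n\|d_j\|$ with $\|\cdot\|$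 the C*-norm of $\mathcal{A}$. Convention: if the maximum in the hypothesis is $0$ (or is over the empty set, when $n=1$), its reciprocal is read as $+\infty$, so the hypothesis on $\|c\|_0$ holds for every $c$. *)

theory Defs
  imports "HOL-Analysis.Analysis"
begin

text \<open>Unital C*-algebras. The distribution only has real normed algebras, so the complex scalar
  multiplication is an extra operation compatible with \<^const>\<open>scaleR\<close>. The unit comes from
  \<^class>\<open>monoid_mult\<close> rather than \<^class>\<open>ring_1\<close> so that the zero algebra is not excluded.\<close>

class unital_cstar_algebra = real_normed_algebra + monoid_mult + banach +
  fixes scaleC :: "complex \<Rightarrow> 'a \<Rightarrow> 'a"
    and adj :: "'a \<Rightarrow> 'a"
  assumes scaleC_add_right: "scaleC z (a + b) = scaleC z a + scaleC z b"
    and scaleC_add_left: "scaleC (z + w) a = scaleC z a + scaleC w a"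
    and scaleC_scaleC: "scaleC z (scaleC w a) = scaleC (z * w) a"
    and scaleC_of_real: "scaleC (complex_of_real r) a = scaleR r a"
    and norm_scaleC: "norm (scaleC z a) = cmod z * norm a"
    and mult_scaleC_left: "scaleC z a * b = scaleC z (a * b)"
    and mult_scaleC_right: "a * scaleC z b = scaleC z (a * b)"
    and adj_adj: "adj (adj a) = a"
    and adj_add: "adj (a + b) = adj a + adj b"
    and adj_scaleC: "adj (scaleC z a) = scaleC (cnj z) (adj a)"
    and adj_mult: "adj (a * b) = adj b * adj a"
    and cstar_identity: "norm (adj a * a) = (norm a)\<^sup>2"

definition cstar_spectrum :: "'a::unital_cstar_algebra \<Rightarrow> complex set" where
  "cstar_spectrum a =
     {z. \<not> (\<exists>b. b * (a - scaleC z 1) = 1 \<and> (a - scaleC z 1) * b = 1)}"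

definition cstar_nonneg :: "'a::unital_cstar_algebra \<Rightarrow> bool" where
  "cstar_nonneg a \<longleftrightarrow> adj a = a \<and> cstar_spectrum a \<subseteq> complex_of_real ` {0..}"

definition cstar_le :: "'a::unital_cstar_algebra \<Rightarrow> 'a \<Rightarrow> bool" where
  "cstar_le a b \<longleftrightarrow> cstar_nonneg (b - a)"

text \<open>The library locale \<open>module\<close> requires commutative scalars, so the module laws
  are spelled out.\<close>

locale hilbert_cstar_module =
  fixes smul :: "'a::unital_cstar_algebra \<Rightarrow> 'e::ab_group_add \<Rightarrow> 'e"
    and ip :: "'e \<Rightarrow> 'e \<Rightarrow> 'a"
  assumes smul_add_right: "smul a (x + y) = smul a x + smul a y"
    and smul_add_left: "smul (a + b) x = smul a x + smul b x"
    and smul_smul: "smul a (smul b x) = smul (a * b) x"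
    and smul_one: "smul 1 x = x"
    and ip_nonneg: "cstar_nonneg (ip x x)"
    and ip_definite: "ip x x = 0 \<Longrightarrow> x = 0"
    and ip_add_left: "ip (x + y) z = ip x z + ip y z"
    and ip_smul_left: "ip (smul a x) y = a * ip x y"
    and ip_adj: "ip x y = adj (ip y x)"
    and complete: "Metric_space.mcomplete UNIV (\<lambda>x y. sqrt (norm (ip (x - y) (x - y))))"

definition finite_rank :: "('a::unital_cstar_algebra \<Rightarrow> 'e::ab_group_add \<Rightarrow> 'e) \<Rightarrow> bool" where
  "finite_rank smul \<longleftrightarrow> (\<exists>S. finite S \<and> (\<forall>x. \<exists>f. x = (\<Sum>s\<in>S. smul (f s) s)))"

definition modular_frame ::
    "('e::ab_group_add \<Rightarrow> 'e \<Rightarrow> 'a::unital_cstar_algebra) \<Rightarrow> ('n::finite \<Rightarrow> 'e) \<Rightarrow> bool" where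
  "modular_frame ip \<tau> \<longleftrightarrow>
     (\<exists>a b::real. a > 0 \<and> b > 0 \<and>
        (\<forall>x. cstar_le (a *\<^sub>R ip x x) (\<Sum>j\<in>UNIV. ip x (\<tau> j) * ip (\<tau> j) x) \<and>
             cstar_le (\<Sum>j\<in>UNIV. ip x (\<tau> j) * ip (\<tau> j) x) (b *\<^sub>R ip x x)))"

definition unit_inner_product_frame ::
    "('e::ab_group_add \<Rightarrow> 'e \<Rightarrow> 'a::unital_cstar_algebra) \<Rightarrow> ('n::finite \<Rightarrow> 'e) \<Rightarrow> bool" where
  "unit_inner_product_frame ip \<tau> \<longleftrightarrow> modular_frame ip \<tau> \<and> (\<forall>j. ip (\<tau> j) (\<tau> j) = 1)"

definition synthesis ::
    "('a::unital_cstar_algebra \<Rightarrow> 'e::ab_group_add \<Rightarrow> 'e) \<Rightarrow> ('n::finite \<Rightarrow> 'e) \<Rightarrow> 'a ^ 'n \<Rightarrow> 'e" where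
  "synthesis smul \<tau> c = (\<Sum>j\<in>UNIV. smul (c $ j) (\<tau> j))"

definition norm0 :: "'a::unital_cstar_algebra ^ 'n::finite \<Rightarrow> nat" where
  "norm0 d = card {j. d $ j \<noteq> 0}"

definition norm1 :: "'a::unital_cstar_algebra ^ 'n::finite \<Rightarrow> real" where
  "norm1 d = (\<Sum>j\<in>UNIV. norm (d $ j))"

definition coherence_set ::
    "('e \<Rightarrow> 'e \<Rightarrow> 'a::unital_cstar_algebra) \<Rightarrow> ('n::finite \<Rightarrow> 'e) \<Rightarrow> real set" where
  "coherence_set ip \<tau> = {norm (ip (\<tau> j) (\<tau> k)) | j k. j \<noteq> k}"

end

theory Submission
  imports Defs
begin

text \<open>If \<open>e = d - c\<close> lies in the kernel of the synthesis map, pairing \<open>\<Sum>j. e\<^sub>j \<tau>\<^sub>j = 0\<close> with \<open>\<tau>\<^sub>k\<close>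
  and using \<open>\<langle>\<tau>\<^sub>k, \<tau>\<^sub>k\<rangle> = 1\<close> bounds \<open>\<parallel>e\<^sub>k\<parallel>\<close> by \<open>\<mu>\<close> times the \<open>\<ell>\<^sup>1\<close> norm of the other entries, where
  \<open>\<mu>\<close> is the coherence. Hence a set of fewer than \<open>(1 + 1/\<mu>)/2\<close> indices carries less than half of
  the \<open>\<ell>\<^sup>1\<close> norm of \<open>e\<close>; applied to the support of \<open>c\<close>, this makes the mass that \<open>e\<close> adds outside
  the support exceed what it can cancel inside.\<close>

lemma (in hilbert_cstar_module) ip_zero_left: "ip 0 y = 0"
  using ip_add_left[of 0 0 y] by simp

lemma (in hilbert_cstar_module) ip_sum_left: "ip (\<Sum>j\<in>A. f j) y = (\<Sum>j\<in>A. ip (f j) y)"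
  by (induction A rule: infinite_finite_induct) (simp_all add: ip_zero_left ip_add_left)

lemma (in hilbert_cstar_module) ip_synthesis:
  "ip (synthesis smul \<tau> d) y = (\<Sum>j\<in>UNIV. d $ j * ip (\<tau> j) y)"
  by (simp add: synthesis_def ip_sum_left ip_smul_left)

text \<open>The \<open>k\<close>-th term is moved to the left so that the factor
  \<open>norm1 e\<close> on the right does not depend on \<open>k\<close>; such bounds can be summed
  over any index set.\<close>

lemma (in hilbert_cstar_module) norm_entry_le_coherence:
  fixes \<tau> :: "'n::finite \<Rightarrow> 'e" and e :: "'a ^ 'n"
  assumes unit: "ip (\<tau> k) (\<tau> k) = 1"
    and coherence: "\<And>j. j \<noteq> k \<Longrightarrow> norm (ip (\<tau> j) (\<tau> k)) \<le> \<mu>"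
    and kernel: "(\<Sum>j\<in>UNIV. e $ j * ip (\<tau> j) (\<tau> k)) = 0"
  shows "(1 + \<mu>) * norm (e $ k) \<le> \<mu> * norm1 e"
proof -
  let ?R = "\<Sum>j\<in>UNIV - {k}. e $ j * ip (\<tau> j) (\<tau> k)"
  have "e $ k + ?R = 0"
    using kernel unit by (simp add: sum.remove[of UNIV k])
  then have "norm (e $ k) = norm ?R"
    by (metis add_eq_0_iff norm_minus_cancel)
  also have "\<dots> \<le> (\<Sum>j\<in>UNIV - {k}. norm (e $ j) * \<mu>)"
    by (intro sum_norm_le order_trans[OF norm_mult_ineq] mult_left_mono coherence) auto
  also have "\<dots> = \<mu> * (norm1 e - norm (e $ k))"
    by (simp add: norm1_def sum.remove[of UNIV k] sum_distrib_left mult.commute)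
  finally show ?thesis
    by (simp add: algebra_simps)
qed

lemma norm1_pos_iff: "norm1 e > 0 \<longleftrightarrow> e \<noteq> 0"
  by (simp add: norm1_def less_le sum_nonneg sum_nonneg_eq_0_iff vec_eq_iff eq_commute[of 0])

text \<open>On the support of \<open>c\<close>, the reverse triangle inequality limits the loss to
  the mass of \<open>e\<close> there; off the support \<open>c\<close> vanishes, so all the mass of
  \<open>e\<close> there is gained. By \<open>half\<close> the gain exceeds the loss.\<close>

lemma norm1_less_add:
  fixes c e :: "'a::unital_cstar_algebra ^ 'n::finite"
  assumes half: "2 * (\<Sum>j | c $ j \<noteq> 0. norm (e $ j)) < norm1 e"
  shows "norm1 c < norm1 (c + e)"
proof -
  let ?S = "{j. c $ j \<noteq> 0}"
  have split: "norm1 v = (\<Sum>j\<in>?S. norm (v $ j)) + (\<Sum>j\<in>- ?S. norm (v $ j))" for v :: "'a ^ 'n"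
    unfolding norm1_def by (subst sum.union_disjoint[symmetric]) (auto intro!: sum.cong)
  have "(\<Sum>j\<in>?S. norm (c $ j)) - (\<Sum>j\<in>?S. norm (e $ j)) \<le> (\<Sum>j\<in>?S. norm ((c + e) $ j))"
    unfolding sum_subtractf[symmetric] by (intro sum_mono) (simp add: norm_diff_ineq)
  moreover have "(\<Sum>j\<in>- ?S. norm ((c + e) $ j)) = (\<Sum>j\<in>- ?S. norm (e $ j))"
    and "(\<Sum>j\<in>- ?S. norm (c $ j)) = 0"
    by (simp_all add: sum.neutral)
  ultimately show ?thesis
    using half split[of c] split[of e] split[of "c + e"] by linarith
qed

text \<open>Clearing the denominator gives a form of the sparsity condition that still makes sense
  for coherence 0, so the degenerate cases need no separate treatment later.\<close>

lemma coherence_bound: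
  fixes ip :: "'e \<Rightarrow> 'e \<Rightarrow> 'a::unital_cstar_algebra" and \<tau> :: "'n::finite \<Rightarrow> 'e"
  assumes "coherence_set ip \<tau> = {} \<or> Max (coherence_set ip \<tau>) = 0 \<or>
           real s < (1 / 2) * (1 + 1 / Max (coherence_set ip \<tau>))"
  obtains \<mu> where "\<mu> \<ge> 0" "\<And>j k. j \<noteq> k \<Longrightarrow> norm (ip (\<tau> j) (\<tau> k)) \<le> \<mu>"
    "2 * real s * \<mu> < 1 + \<mu>"
proof (cases "coherence_set ip \<tau> = {}")
  case True
  then show ?thesis
    \<comment> \<open>There are no two distinct indices: 0 is a vacuous bound, and the last
      inequality reads 0 < 1.\<close>
    using that[of 0] by (auto simp: coherence_set_def)
next
  case False
  let ?\<mu> = "Max (coherence_set ip \<tau>)"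
  have "coherence_set ip \<tau> \<subseteq> range (\<lambda>(j, k). norm (ip (\<tau> j) (\<tau> k)))"
    by (auto simp: coherence_set_def)
  then have fin: "finite (coherence_set ip \<tau>)"
    by (rule finite_subset) simp
  have "?\<mu> \<in> coherence_set ip \<tau>"
    using fin False by (rule Max_in)
  then have nonneg: "?\<mu> \<ge> 0"
    by (auto simp: coherence_set_def)
  have bound: "norm (ip (\<tau> j) (\<tau> k)) \<le> ?\<mu>" if "j \<noteq> k" for j k
    using that by (intro Max_ge fin) (auto simp: coherence_set_def)
  have "2 * real s * ?\<mu> < 1 + ?\<mu>"
  proof (cases "?\<mu> = 0")
    case True
    then show ?thesis by simp
  next
    case nonzero: False
    then have "real s < (1 / 2) * (1 + 1 / ?\<mu>)"
      using assms False by blast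
    then show ?thesis
      using nonneg nonzero by (simp add: field_simps)
  qed
  then show ?thesis
    using that nonneg bound by blast
qed

theorem theorem2p6:
  fixes smul :: "'a::unital_cstar_algebra \<Rightarrow> 'e::ab_group_add \<Rightarrow> 'e"
    and ip :: "'e \<Rightarrow> 'e \<Rightarrow> 'a"
    and \<tau> :: "'n::finite \<Rightarrow> 'e"
    and x :: 'e
    and c :: "'a ^ 'n"
  assumes "hilbert_cstar_module smul ip"
    and "finite_rank smul"
    and "unit_inner_product_frame ip \<tau>"
    and "x = synthesis smul \<tau> c"
    and "coherence_set ip \<tau> = {} \<or> Max (coherence_set ip \<tau>) = 0 \<or>
         real (norm0 c) < (1 / 2) * (1 + 1 / Max (coherence_set ip \<tau>))"
  shows "synthesis smul \<tau> c = x \<and>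
         (\<forall>d. synthesis smul \<tau> d = x \<and> d \<noteq> c \<longrightarrow> norm1 d > norm1 c)"
proof (intro conjI allI impI)
  show "synthesis smul \<tau> c = x"
    using assms(4) by simp
next
  fix d
  assume d: "synthesis smul \<tau> d = x \<and> d \<noteq> c"
  interpret hilbert_cstar_module smul ip by fact
  define e where "e = d - c"
  let ?S = "{j. c $ j \<noteq> 0}"
  obtain \<mu> where \<mu>: "\<mu> \<ge> 0" "\<And>j k. j \<noteq> k \<Longrightarrow> norm (ip (\<tau> j) (\<tau> k)) \<le> \<mu>"
    and sparse: "2 * real (norm0 c) * \<mu> < 1 + \<mu>"
    using coherence_bound[OF assms(5)] by blast
  have kernel: "(\<Sum>j\<in>UNIV. e $ j * ip (\<tau> j) (\<tau> k)) = 0" for k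
    using ip_synthesis[of \<tau> d "\<tau> k"] ip_synthesis[of \<tau> c "\<tau> k"] d assms(4)
    by (simp add: e_def left_diff_distrib sum_subtractf)
  have entry: "(1 + \<mu>) * norm (e $ k) \<le> \<mu> * norm1 e" for k
    using assms(3) \<mu>(2) kernel
    by (intro norm_entry_le_coherence) (auto simp: unit_inner_product_frame_def)
  \<comment> \<open>The uniform bound \<open>entry\<close> is summed over the \<open>norm0 c\<close>
    indices of the support.\<close>
  have "(1 + \<mu>) * (\<Sum>j\<in>?S. norm (e $ j)) \<le> real (norm0 c) * (\<mu> * norm1 e)"
    unfolding sum_distrib_left norm0_def by (intro sum_bounded_above entry)
  then have "(1 + \<mu>) * (2 * (\<Sum>j\<in>?S. norm (e $ j))) \<le> (2 * real (norm0 c) * \<mu>) * norm1 e"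
    by (simp add: mult.assoc mult.left_commute)
  \<comment> \<open>Strictness survives the multiplication because \<open>d \<noteq> c\<close> makes
    \<open>norm1 e\<close> positive.\<close>
  also have "\<dots> < (1 + \<mu>) * norm1 e"
    using sparse d by (intro mult_strict_right_mono) (simp_all add: norm1_pos_iff e_def)
  finally have "2 * (\<Sum>j\<in>?S. norm (e $ j)) < norm1 e"
    using \<mu>(1) by simp
  then show "norm1 c < norm1 d"
    using norm1_less_add[where c = c and e = e] by (simp add: e_def)
qed

end
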